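(* There is an absolute constant $K>0$ such that for every $n\ge 1$, every $f:\{0,1\}^n\to\{0,1\}$, every $\epsilon\in[0,1/2)$ and every product distribution $\mu$ on $\{0,1\}^n$, $$D^{\mu}_{4\epsilon}(f)\le K\cdot \mathrm{corr}^{\times}_{\min,\epsilon}(f)\cdot \mathrm{bs}(f).$$
   Context: Let $f:\{0,1\}^n\to\{0,1\}$ and $[n]=\{1,\dots,n\}$. Distributional query complexity: for a probability distribution $\mu$ on $\{0,1\}^n$ and $\delta\ge 0$, $D^\mu_\delta(f)$ is the minimum, over deterministic query algorithms (decision trees) $\mathcal A$ with $\Pr_{x\sim\mu}[\mathcal A(x)=f(x)]\ge 1-\delta$, of the worst-case (over inputs $x$) number of queried bits of $x$. A product distribution on $\{0,1\}^n$ is a distribution of the form $\mu(x)=\prod_{i\in[n]}\mu_i(x_i)$ with $\mu_i:\{0,1\}\to[0,1]$, $\mu_i(0)+\mu_i(1)=1$. Block sensitivity: for $S\subseteq[n]$, $x^S$ is $x$ with the bits in $S$ flipped. $\mathrm{bs}(f,x)$ is the maximum $k$ such that there are disjoint $B_1,\dots,B_k\subseteq[n]$ with $f(x)\ne f(x^{B_i})$ for all $i$; $\mathrm{bs}(f)=\max_x \mathrm{bs}(f,x)$. Assignments: an assignment is a map $A:[n]\to\{0,1,*\}$, identified with the subcube $\{x: \forall i,\ x_i=A(i)\text{ or }A(i)=*\}$; $|A|=|\{i:A(i)\ne *\}|$ is its co-dimension. Corruption: for a distribution $\mu$ on $\{0,1\}^n$, $\epsilon\geq 0$ and $b\in\{0,1\}$,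 an assignment $A$ is an $\epsilon$-error $b$-certificate under $\mu$ if $\Pr_{x\sim\mu}[x\in A]>0$ and $\Pr_{x\sim\mu}[f(x)\ne b\mid x\in A]\le\epsilon$. Let $\mathrm{corr}^{b,\mu}_\epsilon(f)$ be the minimum of $|A|$ over $\epsilon$-error $b$-certificates $A$ under $\mu$ ($+\infty$ if there is none). The minimum query corruption bound for product distributions is $\mathrm{corr}^{\times}_{\min,\epsilon}(f)=\max_\mu\min_{b\in\{0,1\}}\mathrm{corr}^{b,\mu}_\epsilon(f)$, with $\mu$ ranging over all product distributions on $\{0,1\}^n$ (the inner minimum is always finite). *)

theory Defs
  imports "HOL-Probability.Probability"
begin

text \<open>
  The dimension \<open>n\<close> is an explicit parameter, since the constant in the theorem must not depend on it.
  A point of the cube is a function on \<open>{1..n}\<close>, extended by \<^term>\<open>undefined\<close>. A Boolean function on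
  the cube is a total function on \<^typ>\<open>nat \<Rightarrow> bool\<close>; the definitions below use its values on
  the cube only.
\<close>

definition cube :: "nat \<Rightarrow> (nat \<Rightarrow> bool) set" where
  "cube n = {1..n} \<rightarrow>\<^sub>E UNIV"

text \<open>See \<open>product_distribution_iff\<close> below for the formula with point masses.\<close>

definition product_distribution :: "nat \<Rightarrow> (nat \<Rightarrow> bool) pmf \<Rightarrow> bool" where
  "product_distribution n \<mu> \<longleftrightarrow> (\<exists>p :: nat \<Rightarrow> bool pmf. \<mu> = Pi_pmf {1..n} undefined p)"

datatype decision_tree = Leaf bool | Query nat decision_tree decision_tree

fun queries_within :: "nat \<Rightarrow> decision_tree \<Rightarrow> bool" where
  "queries_within n (Leaf b) \<longleftrightarrow> True"
| "queries_within n (Query i T0 T1) \<longleftrightarrow>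
     i \<in> {1..n} \<and> queries_within n T0 \<and> queries_within n T1"

fun tree_output :: "decision_tree \<Rightarrow> (nat \<Rightarrow> bool) \<Rightarrow> bool" where
  "tree_output (Leaf b) x = b"
| "tree_output (Query i T0 T1) x = tree_output (if x i then T1 else T0) x"

fun num_queries :: "decision_tree \<Rightarrow> (nat \<Rightarrow> bool) \<Rightarrow> nat" where
  "num_queries (Leaf b) x = 0"
| "num_queries (Query i T0 T1) x = Suc (num_queries (if x i then T1 else T0) x)"

definition worst_case_queries :: "nat \<Rightarrow> decision_tree \<Rightarrow> nat" where
  "worst_case_queries n T = Max (num_queries T ` cube n)"

definition distributional_complexity ::
    "nat \<Rightarrow> (nat \<Rightarrow> bool) pmf \<Rightarrow> real \<Rightarrow> ((nat \<Rightarrow> bool) \<Rightarrow> bool) \<Rightarrow> enat" where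
  "distributional_complexity n \<mu> \<delta> f =
     (INF T \<in> {T. queries_within n T \<and>
                  \<P>(x in measure_pmf \<mu>. tree_output T x = f x) \<ge> 1 - \<delta>}.
        enat (worst_case_queries n T))"


definition flip_bits :: "nat set \<Rightarrow> (nat \<Rightarrow> bool) \<Rightarrow> nat \<Rightarrow> bool" where
  "flip_bits S x = (\<lambda>i. if i \<in> S then \<not> x i else x i)"

text \<open>
  A set of blocks describes the same thing as a sequence of disjoint blocks: sensitive blocks
  are nonempty, so disjoint ones are distinct.
\<close>

definition block_sensitivity_at :: "nat \<Rightarrow> ((nat \<Rightarrow> bool) \<Rightarrow> bool) \<Rightarrow> (nat \<Rightarrow> bool) \<Rightarrow> nat" where
  "block_sensitivity_at n f x =
     Max (card ` {\<B>. \<B> \<subseteq> Pow {1..n} \<and> disjoint \<B> \<and> (\<forall>B\<in>\<B>. f x \<noteq> f (flip_bits B x))})"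

definition block_sensitivity :: "nat \<Rightarrow> ((nat \<Rightarrow> bool) \<Rightarrow> bool) \<Rightarrow> nat" where
  "block_sensitivity n f = Max (block_sensitivity_at n f ` cube n)"


text \<open>An assignment is a partial map; \<^term>\<open>None\<close> stands for \<open>*\<close>.\<close>

definition assignments :: "nat \<Rightarrow> (nat \<Rightarrow> bool option) set" where
  "assignments n = {A. dom A \<subseteq> {1..n}}"

definition subcube :: "nat \<Rightarrow> (nat \<Rightarrow> bool option) \<Rightarrow> (nat \<Rightarrow> bool) set" where
  "subcube n A = {x \<in> cube n. \<forall>i\<in>{1..n}. A i = Some (x i) \<or> A i = None}"

definition codim :: "(nat \<Rightarrow> bool option) \<Rightarrow> nat" where
  "codim A = card (dom A)"

definition error_certificate ::
    "nat \<Rightarrow> (nat \<Rightarrow> bool) pmf \<Rightarrow> real \<Rightarrow> bool \<Rightarrow> ((nat \<Rightarrow> bool) \<Rightarrow> bool) \<Rightarrow> (nat \<Rightarrow> bool option) \<Rightarrow> bool" where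
  "error_certificate n \<mu> \<epsilon> b f A \<longleftrightarrow>
     A \<in> assignments n \<and>
     \<P>(x in measure_pmf \<mu>. x \<in> subcube n A) > 0 \<and>
     \<P>(x in measure_pmf \<mu>. f x \<noteq> b \<bar> x \<in> subcube n A) \<le> \<epsilon>"

text \<open>In \<^typ>\<open>enat\<close>, the infimum of the empty set is infinity.\<close>

definition corruption ::
    "nat \<Rightarrow> bool \<Rightarrow> (nat \<Rightarrow> bool) pmf \<Rightarrow> real \<Rightarrow> ((nat \<Rightarrow> bool) \<Rightarrow> bool) \<Rightarrow> enat" where
  "corruption n b \<mu> \<epsilon> f = (INF A \<in> {A. error_certificate n \<mu> \<epsilon> b f A}. enat (codim A))"

text \<open>
  The supremum is a maximum, as all values are integers bounded by \<open>n\<close>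
  (\<open>product_min_corruption_le\<close> below).
\<close>

definition product_min_corruption :: "nat \<Rightarrow> real \<Rightarrow> ((nat \<Rightarrow> bool) \<Rightarrow> bool) \<Rightarrow> enat" where
  "product_min_corruption n \<epsilon> f =
     (SUP \<mu> \<in> {\<mu>. product_distribution n \<mu>}. INF b \<in> UNIV. corruption n b \<mu> \<epsilon> f)"


lemma finite_cube: "finite (cube n)"
  unfolding cube_def by (intro finite_PiE) auto

lemma set_pmf_product_subset:
  assumes "product_distribution n \<mu>"
  shows "set_pmf \<mu> \<subseteq> cube n"
proof -
  obtain p where p: "\<mu> = Pi_pmf {1..n} undefined p"
    using assms unfolding product_distribution_def by blast
  show ?thesis
    unfolding p cube_def using set_Pi_pmf_subset[of "{1..n}" undefined p]
    by (auto simp: PiE_def extensional_def)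
qed

lemma product_distribution_iff:
  "product_distribution n \<mu> \<longleftrightarrow>
     set_pmf \<mu> \<subseteq> cube n \<and>
     (\<exists>p :: nat \<Rightarrow> bool pmf. \<forall>x\<in>cube n. pmf \<mu> x = (\<Prod>i\<in>{1..n}. pmf (p i) (x i)))"
proof -
  have eq: "pmf (Pi_pmf {1..n} undefined p) x = (\<Prod>i\<in>{1..n}. pmf (p i) (x i))"
    if "x \<in> cube n" for p :: "nat \<Rightarrow> bool pmf" and x
    using that unfolding cube_def by (intro pmf_Pi') (auto simp: PiE_def extensional_def)
  show ?thesis (is "_ \<longleftrightarrow> ?sub \<and> ?ex")
  proof
    assume "product_distribution n \<mu>"
    then show "?sub \<and> ?ex"
      using set_pmf_product_subset eq unfolding product_distribution_def by blast
  next
    assume R: "?sub \<and> ?ex"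
    then obtain p :: "nat \<Rightarrow> bool pmf"
      where p: "\<forall>x\<in>cube n. pmf \<mu> x = (\<Prod>i\<in>{1..n}. pmf (p i) (x i))" by blast
    have sub: "set_pmf (Pi_pmf {1..n} undefined p) \<subseteq> cube n"
      by (rule set_pmf_product_subset) (auto simp: product_distribution_def)
    have "\<mu> = Pi_pmf {1..n} undefined p"
    proof (rule pmf_eqI)
      fix x show "pmf \<mu> x = pmf (Pi_pmf {1..n} undefined p) x"
      proof (cases "x \<in> cube n")
        case True then show ?thesis using p eq by simp
      next
        case False
        then have "x \<notin> set_pmf \<mu>" "x \<notin> set_pmf (Pi_pmf {1..n} undefined p)"
          using R sub by auto
        then show ?thesis by (metis pmf_eq_0_set_pmf)
      qed
    qed
    then show "product_distribution n \<mu>" unfolding product_distribution_def by blast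
  qed
qed

lemma min_corruption_le:
  assumes "set_pmf \<mu> \<subseteq> cube n" and "0 \<le> \<epsilon>"
  shows "(INF b \<in> UNIV. corruption n b \<mu> \<epsilon> f) \<le> enat n"
proof -
  obtain x where x: "x \<in> set_pmf \<mu>" using set_pmf_not_empty[of \<mu>] by blast
  define A where "A = (\<lambda>i. if i \<in> {1..n} then Some (x i) else None)"
  have dom: "dom A = {1..n}" by (auto simp: A_def dom_def)
  have "subcube n A = {x}"
  proof -
    have "y = x" if "y \<in> subcube n A" for y
      using that x assms(1)
      by (intro extensionalityI[of y "{1..n}"])
         (auto simp: subcube_def A_def cube_def PiE_def subset_iff)
    moreover have "x \<in> subcube n A" using x assms(1) by (auto simp: subcube_def A_def)
    ultimately show ?thesis by blast
  qed
  then have "error_certificate n \<mu> \<epsilon> (f x) f A"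
    using dom x assms(2)
    by (auto simp: error_certificate_def assignments_def cond_prob_def measure_pmf_single
        pmf_positive conj_commute cong: conj_cong)
  then have "corruption n (f x) \<mu> \<epsilon> f \<le> enat (codim A)"
    unfolding corruption_def by (intro INF_lower) simp
  also have "codim A = n" by (simp add: codim_def dom)
  finally show ?thesis by (intro INF_lower2[of "f x"]) auto
qed

lemma product_min_corruption_le:
  assumes "0 \<le> \<epsilon>"
  shows "product_min_corruption n \<epsilon> f \<le> enat n"
  unfolding product_min_corruption_def
  by (rule SUP_least, rule min_corruption_le) (use assms set_pmf_product_subset in auto)

end

theory Submission
  imports Defs
begin

text \<open>
  Conditioned on the queried bits, the input still has a product distribution, so the corruption
  bound \<open>c\<close> supplies an \<open>\<epsilon>\<close>-error certificate \<open>Q\<close> of codimension at most \<open>c\<close> for it. Query all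
  variables of \<open>Q\<close>, repeat this \<open>4 bs(f)\<close> times and output the majority of the values certified.
  Overwriting \<open>x\<close> by \<open>Q\<close> gives a random point distributed as the input conditioned on \<open>Q\<close>, so in each
  round \<open>f\<close> takes the certified value there except with probability \<open>\<epsilon>\<close>. In a round where it does, and
  the certified value differs from \<open>f x\<close>, the coordinates in which \<open>x\<close> and \<open>Q\<close> disagree form a
  sensitive block for \<open>x\<close>. These blocks are disjoint, so there are at most \<open>bs(f)\<close> such rounds, and a
  wrong majority forces at least \<open>bs(f)\<close> failed rounds. As \<open>4 bs(f) \<epsilon>\<close> of them are expected, Markov's
  inequality bounds the error by \<open>4\<epsilon>\<close>.
\<close>

section \<open>Trees that query a list of variables\<close>

text \<open>The answers accumulate in \<open>y\<close> and are handed to the continuation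
  \<open>T\<close>, so that the next certificate may depend on them.\<close>

fun query_all :: "nat list \<Rightarrow> (nat \<Rightarrow> bool) \<Rightarrow> ((nat \<Rightarrow> bool) \<Rightarrow> decision_tree) \<Rightarrow> decision_tree" where
  "query_all [] y T = T y"
| "query_all (i # is) y T =
     Query i (query_all is (y(i := False)) T) (query_all is (y(i := True)) T)"

lemma query_all_run:
  "tree_output (query_all is y T) x = tree_output (T (\<lambda>i. if i \<in> set is then x i else y i)) x"
  "num_queries (query_all is y T) x =
     length is + num_queries (T (\<lambda>i. if i \<in> set is then x i else y i)) x"
proof (induction "is" arbitrary: y)
  case (Cons j js)
  have eq: "(\<lambda>i. if i \<in> set js then x i else (y(j := x j)) i) =
      (\<lambda>i. if i \<in> set (j # js) then x i else y i)" for y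
    by auto
  { case 1
    have "tree_output (query_all (j # js) y T) x = tree_output (query_all js (y(j := x j)) T) x"
      by (cases "x j") simp_all
    then show ?case by (simp only: Cons eq) }
  { case 2
    have "num_queries (query_all (j # js) y T) x = Suc (num_queries (query_all js (y(j := x j)) T) x)"
      by (cases "x j") simp_all
    then show ?case by (simp add: Cons eq) }
qed auto

lemma queries_within_query_all:
  assumes "set is \<subseteq> {1..n}" and "\<And>y. queries_within n (T y)"
  shows "queries_within n (query_all is y T)"
  using assms by (induction "is" arbitrary: y) auto

section \<open>Product distributions with some coordinates fixed\<close>

text \<open>Conditioning on the answers \<open>y\<close> in \<open>D\<close>, expressed on the
  marginals. The result is again a product, and it makes sense even when the answers have
  probability 0.\<close>

definition fix_marginals ::
    "nat set \<Rightarrow> (nat \<Rightarrow> bool) \<Rightarrow> (nat \<Rightarrow> bool pmf) \<Rightarrow> nat \<Rightarrow> bool pmf" where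
  "fix_marginals D y p = (\<lambda>i. if i \<in> D then return_pmf (y i) else p i)"

lemma fix_marginals_cong:
  "(\<And>i. i \<in> D \<Longrightarrow> y i = y' i) \<Longrightarrow> fix_marginals D y p = fix_marginals D y' p"
  by (auto simp: fix_marginals_def)

definition cube_pmf :: "nat \<Rightarrow> (nat \<Rightarrow> bool pmf) \<Rightarrow> (nat \<Rightarrow> bool) pmf" where
  "cube_pmf n p = Pi_pmf {1..n} undefined p"

text \<open>Coordinatewise, either the drawn value is kept or a fresh one is drawn from the same
  \<open>p i\<close>. This is the law of total probability over the answers in
  \<open>D\<close>.\<close>

lemma cube_pmf_resample:
  "bind_pmf (cube_pmf n p) (\<lambda>y. cube_pmf n (fix_marginals D y p))
     = cube_pmf n p"
proof -
  have "Pi_pmf {1..n} undefined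
      (\<lambda>i. bind_pmf (p i) (\<lambda>v. if i \<in> D then return_pmf v else p i)) =
    bind_pmf (Pi_pmf {1..n} undefined p) (\<lambda>y. Pi_pmf {1..n} undefined
      (\<lambda>i. if i \<in> D then return_pmf (y i) else p i))"
    by (rule Pi_pmf_bind) simp
  moreover have "(\<lambda>i. bind_pmf (p i) (\<lambda>v. if i \<in> D then return_pmf v else p i)) = p"
  proof
    fix i show "bind_pmf (p i) (\<lambda>v. if i \<in> D then return_pmf v else p i) = p i"
      by (cases "i \<in> D") (simp_all add: bind_return_pmf')
  qed
  ultimately show ?thesis by (simp add: cube_pmf_def fix_marginals_def)
qed

lemma set_cube_pmf:
  "set_pmf (cube_pmf n p) = {x \<in> cube n. \<forall>i\<in>{1..n}. x i \<in> set_pmf (p i)}"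
  unfolding cube_pmf_def by (subst set_Pi_pmf) (auto simp: cube_def PiE_dflt_def PiE_def extensional_def Pi_def)

lemma set_fix_marginals:
  assumes "x \<in> set_pmf (cube_pmf n (fix_marginals D y p))" and "D \<subseteq> {1..n}" and "i \<in> D"
  shows "x i = y i"
proof -
  have "x i \<in> set_pmf (fix_marginals D y p i)"
    using assms unfolding set_cube_pmf by blast
  then show ?thesis using assms(3) by (simp add: fix_marginals_def)
qed

lemma finite_set_cube_pmf: "finite (set_pmf (cube_pmf n (p :: nat \<Rightarrow> bool pmf)))"
  unfolding set_cube_pmf using finite_cube by simp

lemma expectation_resample:
  fixes p :: "nat \<Rightarrow> bool pmf" and h :: "(nat \<Rightarrow> bool) \<Rightarrow> real"
  shows "measure_pmf.expectation (cube_pmf n p) h =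
    measure_pmf.expectation (cube_pmf n p)
      (\<lambda>y. measure_pmf.expectation (cube_pmf n (fix_marginals D y p)) h)"
proof -
  let ?P = "cube_pmf n"
  have "measure_pmf.expectation (?P p) h =
      measure_pmf.expectation (bind_pmf (?P p) (\<lambda>y. ?P (fix_marginals D y p))) h"
    by (simp only: cube_pmf_resample)
  also have "\<dots> = (\<Sum>y\<in>set_pmf (?P p).
      pmf (?P p) y *\<^sub>R measure_pmf.expectation (?P (fix_marginals D y p)) h)"
    by (rule pmf_expectation_bind) (auto simp: finite_set_cube_pmf)
  also have "\<dots> = measure_pmf.expectation (?P p)
      (\<lambda>y. measure_pmf.expectation (?P (fix_marginals D y p)) h)"
    by (rule integral_measure_pmf[symmetric]) (auto simp: finite_set_cube_pmf)
  finally show ?thesis .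
qed

text \<open>For a product distribution, conditioning on a subcube amounts to overwriting the
  coordinates fixed by it.\<close>

lemma certificate_error_overwrite:
  fixes p :: "nat \<Rightarrow> bool pmf"
  assumes "error_certificate n (cube_pmf n p) \<epsilon> b f Q"
  shows "measure_pmf.prob (cube_pmf n p)
      {x. f (override_on x (the \<circ> Q) (dom Q)) \<noteq> b} \<le> \<epsilon>"
proof -
  let ?P = "cube_pmf n"
  let ?R = "?P (fix_marginals (dom Q) (the \<circ> Q) p)"
  let ?z = "\<lambda>x. override_on x (the \<circ> Q) (dom Q)"
  have dom: "dom Q \<subseteq> {1..n}"
    and pos: "measure_pmf.prob (?P p) (subcube n Q) > 0"
    and err: "measure_pmf.prob (?P p) {x. f x \<noteq> b \<and> x \<in> subcube n Q} \<le>
      \<epsilon> * measure_pmf.prob (?P p) (subcube n Q)"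
    using assms by (auto simp: error_certificate_def assignments_def cond_prob_def field_simps)
  have prob: "measure_pmf.prob M A = measure_pmf.expectation M (indicator A)"
    for M :: "(nat \<Rightarrow> bool) pmf" and A
    by simp
  \<comment> \<open>Average over the values of \<open>y\<close> on \<open>dom Q\<close>. Only a
    \<open>y\<close> that agrees with \<open>Q\<close> contributes, and then the conditioned
    distribution is \<open>?R\<close>, whatever \<open>y\<close> is. The probability thus
    factors.\<close>
  have "measure_pmf.prob (?P p) {x. f x \<noteq> b \<and> x \<in> subcube n Q} =
    measure_pmf.expectation (?P p) (\<lambda>y. measure_pmf.prob
      (?P (fix_marginals (dom Q) y p)) {x. f x \<noteq> b \<and> x \<in> subcube n Q})"
    unfolding prob by (rule expectation_resample)
  also have "\<dots> = measure_pmf.expectation (?P p)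
      (\<lambda>y. indicator (subcube n Q) y * measure_pmf.prob ?R {x. f x \<noteq> b})"
  proof -
    have "measure_pmf.prob (?P (fix_marginals (dom Q) y p)) {x. f x \<noteq> b \<and> x \<in> subcube n Q} =
      indicator (subcube n Q) y * measure_pmf.prob ?R {x. f x \<noteq> b}"
      if y: "y \<in> set_pmf (?P p)" for y
    proof (cases "y \<in> subcube n Q")
      case True
      have eq: "fix_marginals (dom Q) y p = fix_marginals (dom Q) (the \<circ> Q) p"
        using True dom by (intro fix_marginals_cong) (fastforce simp: subcube_def)
      have "x \<in> subcube n Q" if x: "x \<in> set_pmf ?R" for x
      proof -
        have "x \<in> cube n" using x by (simp add: set_cube_pmf)
        moreover have "Q i = Some (x i)" if "i \<in> dom Q" for i
          using set_fix_marginals[OF x dom that] that by auto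
        ultimately show ?thesis unfolding subcube_def by blast
      qed
      then have "measure_pmf.prob ?R {x. f x \<noteq> b \<and> x \<in> subcube n Q} =
          measure_pmf.prob ?R {x. f x \<noteq> b}"
        by (intro measure_pmf.finite_measure_eq_AE) (auto simp: AE_measure_pmf_iff)
      then show ?thesis using True eq by simp
    next
      case False
      then obtain i where i: "i \<in> {1..n}" "i \<in> dom Q" "Q i \<noteq> Some (y i)"
        using y by (fastforce simp: subcube_def set_cube_pmf)
      have "x \<notin> subcube n Q" if x: "x \<in> set_pmf (?P (fix_marginals (dom Q) y p))" for x
        using set_fix_marginals[OF x dom i(2)] i unfolding subcube_def by force
      then have "measure_pmf.prob (?P (fix_marginals (dom Q) y p))
          {x. f x \<noteq> b \<and> x \<in> subcube n Q} = 0"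
        by (auto simp: measure_pmf_zero_iff)
      then show ?thesis using False by simp
    qed
    then show ?thesis
      by (intro integral_cong_AE) (simp_all add: AE_measure_pmf_iff)
  qed
  also have "\<dots> = measure_pmf.prob (?P p) (subcube n Q) * measure_pmf.prob ?R {x. f x \<noteq> b}"
    by simp
  finally have R: "measure_pmf.prob ?R {x. f x \<noteq> b} \<le> \<epsilon>"
    using err pos by (simp add: mult.commute)
  \<comment> \<open>Each marginal of \<open>?R\<close> arises by drawing from \<open>p i\<close> and
    then replacing the value if \<open>Q\<close> fixes it.\<close>
  have "?R = map_pmf ?z (?P p)"
  proof -
    have "?R = bind_pmf (?P p) (\<lambda>y. ?P (\<lambda>i. return_pmf (?z y i)))"
    proof -
      have "?P (\<lambda>i. bind_pmf (p i)
          (\<lambda>v. return_pmf (if i \<in> dom Q then the (Q i) else v))) =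
        bind_pmf (?P p) (\<lambda>y. ?P (\<lambda>i. return_pmf (if i \<in> dom Q then the (Q i) else y i)))"
        unfolding cube_pmf_def by (rule Pi_pmf_bind) simp
      moreover have "fix_marginals (dom Q) (the \<circ> Q) p =
          (\<lambda>i. bind_pmf (p i) (\<lambda>v. return_pmf (if i \<in> dom Q then the (Q i) else v)))"
        by (auto simp: fix_marginals_def bind_return_pmf' fun_eq_iff)
      ultimately show ?thesis by (simp add: override_on_def comp_def)
    qed
    also have "\<dots> = bind_pmf (?P p) (\<lambda>y. return_pmf (?z y))"
    proof (rule bind_pmf_cong[OF refl])
      fix y assume y: "y \<in> set_pmf (?P p)"
      have "(\<lambda>i. if i \<in> {1..n} then ?z y i else undefined) = ?z y"
        using y dom by (auto simp: set_cube_pmf cube_def override_on_def PiE_def extensional_def fun_eq_iff)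
      then show "?P (\<lambda>i. return_pmf (?z y i)) = return_pmf (?z y)"
        by (simp add: cube_pmf_def Pi_pmf_return_pmf)
    qed
    finally show ?thesis by (simp add: map_pmf_def)
  qed
  then show ?thesis using R by (simp add: vimage_def)
qed

section \<open>Sensitive blocks and rounds of certificates\<close>

lemma sensitive_blocks_card_le:
  assumes "x \<in> cube n" and "\<B> \<subseteq> Pow {1..n}" and "disjoint \<B>"
    and "\<forall>B\<in>\<B>. f x \<noteq> f (flip_bits B x)"
  shows "card \<B> \<le> block_sensitivity n f"
proof -
  have "finite {\<B>. \<B> \<subseteq> Pow {1..n} \<and> disjoint \<B> \<and> (\<forall>B\<in>\<B>. f x \<noteq> f (flip_bits B x))}"
    by (rule finite_subset[of _ "Pow (Pow {1..n})"]) auto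
  then have "card \<B> \<le> block_sensitivity_at n f x"
    unfolding block_sensitivity_at_def using assms by (intro Max_ge) auto
  also have "\<dots> \<le> block_sensitivity n f"
    unfolding block_sensitivity_def using assms(1) finite_cube by (intro Max_ge) auto
  finally show ?thesis .
qed

text \<open>The corruption bound is a supremum over all product distributions, so the same
  \<open>c\<close> serves the distribution reached after any answers.\<close>

lemma exists_certificate:
  assumes "product_min_corruption n \<epsilon> f = enat c"
  obtains b Q where "error_certificate n (cube_pmf n p) \<epsilon> b f Q" and "codim Q \<le> c"
proof -
  have "(INF b \<in> UNIV. corruption n b (cube_pmf n p) \<epsilon> f) \<le> enat c"
    unfolding assms[symmetric] product_min_corruption_def
    by (rule SUP_upper) (auto simp: product_distribution_def cube_pmf_def)
  \<comment> \<open>A strict bound allows witnesses to be extracted from the infima.\<close>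
  also have "\<dots> < enat (Suc c)" by simp
  finally show ?thesis
    using that by (auto simp: INF_less_iff corruption_def)
qed

text \<open>Coordinates already queried have deterministic marginals in \<open>p\<close>. For an input \<open>x\<close>, \<open>N x\<close> counts
  the rounds that certify \<open>True\<close>, and \<open>g x\<close> the rounds whose certificate fails when \<open>x\<close> is overwritten
  by it. The number \<open>k\<close> of \<open>True\<close>-certificates from previous rounds is generalised over for the
  induction. Excluding deterministic coordinates from the blocks makes those of later rounds
  disjoint from the current one.\<close>

lemma certificate_rounds:
  assumes c: "product_min_corruption n \<epsilon> f = enat c"
  shows "\<exists>T N g. queries_within n T \<and> (\<forall>x. num_queries T x \<le> t * c) \<and>
    (\<forall>x. tree_output T x \<longleftrightarrow> m < k + N x) \<and>
    measure_pmf.expectation (cube_pmf n p) (\<lambda>x. real (g x)) \<le> \<epsilon> * real t \<and>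
    (\<forall>x\<in>set_pmf (cube_pmf n p). N x \<le> t \<and> (\<exists>\<B>. \<B> \<subseteq> Pow {i\<in>{1..n}. \<forall>b. p i \<noteq> return_pmf b} \<and>
       disjoint \<B> \<and> (\<forall>B\<in>\<B>. f x \<noteq> f (flip_bits B x)) \<and>
       (if f x then t - N x else N x) \<le> card \<B> + g x))"
proof (induction t arbitrary: k p)
  case 0
  show ?case
    by (rule exI[of _ "Leaf (m < k)"], rule exI[of _ "\<lambda>_. 0"], rule exI[of _ "\<lambda>_. 0"])
      (auto intro!: exI[of _ "{}"])
next
  case (Suc t)
  obtain b Q where cert: "error_certificate n (cube_pmf n p) \<epsilon> b f Q" and codim: "codim Q \<le> c"
    using exists_certificate[OF c] .
  define D where "D = dom Q"
  define z where "z x = override_on x (the \<circ> Q) D" for x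
  \<comment> \<open>The part of \<open>x\<close> revealed by this round; \<open>False\<close> is the
    default with which \<open>query_all\<close> starts below.\<close>
  define r where "r x = (\<lambda>i. if i \<in> D then x i else False)" for x
  define free where "free p = {i\<in>{1..n}. \<forall>b. p i \<noteq> return_pmf b}" for p :: "nat \<Rightarrow> bool pmf"
  have D: "D \<subseteq> {1..n}" "finite D"
    using cert finite_subset[of D "{1..n}"] by (auto simp: error_certificate_def assignments_def D_def)
  have Q_supp: "the (Q i) \<in> set_pmf (p i)" if "i \<in> D" for i
  proof -
    have "set_pmf (cube_pmf n p) \<inter> subcube n Q \<noteq> {}"
      using cert measure_pmf_zero_iff[of "cube_pmf n p" "subcube n Q"]
      by (auto simp: error_certificate_def)
    then obtain w where "w \<in> set_pmf (cube_pmf n p)" "w \<in> subcube n Q" by blast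
    then show ?thesis
      using that D by (force simp: set_cube_pmf subcube_def D_def)
  qed
  have r_eq: "fix_marginals D (r y) p = fix_marginals D y p" for y
    by (rule fix_marginals_cong) (simp add: r_def)
  \<comment> \<open>The induction hypothesis after answers \<open>y\<close>, with the vote
    \<open>b\<close> of this round added to \<open>k\<close>.\<close>
  define good where "good y T N g \<longleftrightarrow> queries_within n T \<and> (\<forall>x. num_queries T x \<le> t * c) \<and>
    (\<forall>x. tree_output T x \<longleftrightarrow> m < (k + of_bool b) + N x) \<and>
    measure_pmf.expectation (cube_pmf n (fix_marginals D y p)) (\<lambda>x. real (g x)) \<le> \<epsilon> * real t \<and>
    (\<forall>x\<in>set_pmf (cube_pmf n (fix_marginals D y p)). N x \<le> t \<and>
       (\<exists>\<B>. \<B> \<subseteq> Pow (free (fix_marginals D y p)) \<and>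
       disjoint \<B> \<and> (\<forall>B\<in>\<B>. f x \<noteq> f (flip_bits B x)) \<and>
       (if f x then t - N x else N x) \<le> card \<B> + g x))" for y T N g
  have "\<forall>y. \<exists>T N g. good y T N g"
    unfolding good_def free_def by (intro allI Suc.IH)
  then obtain T N g where good: "\<And>y. good y (T y) (N y) (g y)"
    by metis
  have T: "queries_within n (T y)" "num_queries (T y) x \<le> t * c"
      "tree_output (T y) x \<longleftrightarrow> m < (k + of_bool b) + N y x"
    and g: "measure_pmf.expectation (cube_pmf n (fix_marginals D y p))
      (\<lambda>x. real (g y x)) \<le> \<epsilon> * real t" for x y
    using good[of y] unfolding good_def by simp_all
  have N: "N y x \<le> t"
    and blocks: "\<exists>\<B>. \<B> \<subseteq> Pow (free (fix_marginals D y p)) \<and>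
       disjoint \<B> \<and> (\<forall>B\<in>\<B>. f x \<noteq> f (flip_bits B x)) \<and>
       (if f x then t - N y x else N y x) \<le> card \<B> + g y x"
    if "x \<in> set_pmf (cube_pmf n (fix_marginals D y p))" for x y
    using good[of y] that unfolding good_def by blast+
  define T' where "T' = query_all (sorted_list_of_set D) (\<lambda>_. False) T"
  define N' where "N' x = of_bool b + N (r x) x" for x
  define g' where "g' x = of_bool (f (z x) \<noteq> b) + g (r x) x" for x
  have T'_run: "tree_output T' x = tree_output (T (r x)) x"
    "num_queries T' x = card D + num_queries (T (r x)) x" for x
    using D by (simp_all add: T'_def query_all_run r_def)
  have "queries_within n T'"
    unfolding T'_def using D T(1) by (intro queries_within_query_all) auto
  moreover have "num_queries T' x \<le> Suc t * c" for x
    using T(2)[of "r x" x] codim by (simp add: T'_run codim_def D_def)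
  moreover have "tree_output T' x \<longleftrightarrow> m < k + N' x" for x
    by (simp add: T'_run T(3) N'_def add.assoc)
  moreover have "measure_pmf.expectation (cube_pmf n p) (\<lambda>x. real (g' x)) \<le> \<epsilon> * real (Suc t)"
  proof -
    have int: "integrable (cube_pmf n q) h" for q and h :: "_ \<Rightarrow> real"
      by (rule integrable_measure_pmf_finite) (rule finite_set_cube_pmf)
    have "measure_pmf.expectation (cube_pmf n p) (\<lambda>x. real (g' x)) =
        measure_pmf.expectation (cube_pmf n p) (indicator {x. f (z x) \<noteq> b}) +
        measure_pmf.expectation (cube_pmf n p) (\<lambda>x. real (g (r x) x))"
      unfolding g'_def by (subst Bochner_Integration.integral_add[symmetric])
        (auto intro!: int Bochner_Integration.integral_cong simp: indicator_def)
    moreover have "measure_pmf.expectation (cube_pmf n p) (indicator {x. f (z x) \<noteq> b}) \<le> \<epsilon>"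
      using certificate_error_overwrite[OF cert] by (simp add: z_def D_def)
    moreover have "measure_pmf.expectation (cube_pmf n p) (\<lambda>x. real (g (r x) x)) \<le> \<epsilon> * real t"
    proof -
      \<comment> \<open>Once the answers in \<open>D\<close> are fixed, \<open>r x\<close> is
        constant on the support, so a single subtree with its own bound is involved.\<close>
      have eq: "measure_pmf.expectation (cube_pmf n (fix_marginals D y p)) (\<lambda>x. real (g (r x) x)) =
          measure_pmf.expectation (cube_pmf n (fix_marginals D (r y) p)) (\<lambda>x. real (g (r y) x))" for y
      proof -
        have "r x = r y" if x: "x \<in> set_pmf (cube_pmf n (fix_marginals D y p))" for x
          using set_fix_marginals[OF x D(1)] by (auto simp: r_def)
        then show ?thesis
          unfolding r_eq by (intro integral_cong_AE) (auto simp: AE_measure_pmf_iff)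
      qed
      have "measure_pmf.expectation (cube_pmf n p) (\<lambda>x. real (g (r x) x)) =
        measure_pmf.expectation (cube_pmf n p) (\<lambda>y. measure_pmf.expectation
          (cube_pmf n (fix_marginals D y p)) (\<lambda>x. real (g (r x) x)))"
        by (rule expectation_resample)
      also have "\<dots> \<le> measure_pmf.expectation (cube_pmf n p) (\<lambda>y. \<epsilon> * real t)"
        unfolding eq by (intro integral_mono int g)
      finally show ?thesis by simp
    qed
    ultimately show ?thesis by (simp add: algebra_simps)
  qed
  moreover have "N' x \<le> Suc t \<and> (\<exists>\<B>. \<B> \<subseteq> Pow (free p) \<and>
       disjoint \<B> \<and> (\<forall>B\<in>\<B>. f x \<noteq> f (flip_bits B x)) \<and>
       (if f x then Suc t - N' x else N' x) \<le> card \<B> + g' x)"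
    if x: "x \<in> set_pmf (cube_pmf n p)" for x
  proof -
    have x': "x \<in> set_pmf (cube_pmf n (fix_marginals D (r x) p))"
      using x unfolding r_eq by (auto simp: set_cube_pmf fix_marginals_def)
    \<comment> \<open>Keeps the natural subtraction in \<open>t - N (r x) x\<close> from
      truncating.\<close>
    have N_le: "N (r x) x \<le> t" using N[OF x'] .
    obtain \<B> where \<B>: "\<B> \<subseteq> Pow (free (fix_marginals D (r x) p))" "disjoint \<B>"
      "\<forall>B\<in>\<B>. f x \<noteq> f (flip_bits B x)"
      "(if f x then t - N (r x) x else N (r x) x) \<le> card \<B> + g (r x) x"
      using blocks[OF x'] by blast
    have free: "free (fix_marginals D (r x) p) = free p - D"
      by (auto simp: free_def fix_marginals_def)
    show ?thesis
    proof (cases "f (z x) = b \<and> b \<noteq> f x")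
      \<comment> \<open>Either the vote is correct and adds no wrong vote, or the certificate fails
        and \<open>g'\<close> grows by one; the later blocks suffice.\<close>
      case False
      then have "(if f x then Suc t - N' x else N' x) \<le> card \<B> + g' x"
        using \<B>(4) N_le by (auto simp: N'_def g'_def split: if_splits)
      then show ?thesis
        using \<B>(1-3) N_le unfolding free by (intro conjI exI[of _ \<B>]) (auto simp: N'_def)
    next
      case True
      define B where "B = {i\<in>D. x i \<noteq> the (Q i)}"
      have "flip_bits B x = z x"
        by (auto simp: flip_bits_def B_def z_def override_on_def fun_eq_iff)
      then have sens: "f x \<noteq> f (flip_bits B x)" using True by auto
      \<comment> \<open>On \<open>B\<close> both \<open>x i\<close> and the value in
        \<open>Q\<close> lie in the support of \<open>p i\<close>, and they differ, so
        \<open>p i\<close> is not deterministic.\<close>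
      have "B \<subseteq> free p"
      proof
        fix i assume i: "i \<in> B"
        then have "i \<in> {1..n}" and vals: "the (Q i) \<in> set_pmf (p i)" "x i \<in> set_pmf (p i)"
            "x i \<noteq> the (Q i)"
          using x D Q_supp[of i] unfolding B_def set_cube_pmf by blast+
        moreover have "p i \<noteq> return_pmf v" for v
          using vals by (metis set_return_pmf singletonD)
        ultimately show "i \<in> free p" unfolding free_def by blast
      qed
      have BD: "B \<subseteq> D" by (auto simp: B_def)
      have "B \<noteq> {}" using sens by (auto simp: flip_bits_def)
      have "B \<notin> \<B>" using \<B>(1) BD \<open>B \<noteq> {}\<close> unfolding free by blast
      have "finite \<B>"
        using \<B>(1) by (rule finite_subset) (simp add: free_def)
      have "disjoint (insert B \<B>)"
        using \<B>(1,2) BD unfolding free disjoint_def by blast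
      moreover have "insert B \<B> \<subseteq> Pow (free p)"
        using \<open>B \<subseteq> free p\<close> \<B>(1) unfolding free by auto
      moreover have "(if f x then Suc t - N' x else N' x) \<le> card (insert B \<B>) + g' x"
        using True \<B>(4) N_le \<open>finite \<B>\<close> \<open>B \<notin> \<B>\<close> by (auto simp: N'_def g'_def split: if_splits)
      ultimately show ?thesis
        using sens \<B>(3) N_le by (intro conjI exI[of _ "insert B \<B>"]) (auto simp: N'_def)
    qed
  qed
  ultimately show ?case
    unfolding free_def by (intro exI[of _ T'] exI[of _ N'] exI[of _ g'] conjI allI ballI) blast+
qed

section \<open>Majority vote and error bound\<close>

lemma distributional_complexity_le:
  assumes "queries_within n T" and "measure_pmf.prob \<mu> {x. tree_output T x = f x} \<ge> 1 - \<delta>"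
    and "\<And>x. num_queries T x \<le> d"
  shows "distributional_complexity n \<mu> \<delta> f \<le> enat d"
proof -
  have "worst_case_queries n T \<le> d"
    unfolding worst_case_queries_def using assms(3) finite_cube
    by (subst Max_le_iff) (auto simp: cube_def PiE_eq_empty_iff)
  moreover have "distributional_complexity n \<mu> \<delta> f \<le> enat (worst_case_queries n T)"
    unfolding distributional_complexity_def using assms by (intro INF_lower) auto
  ultimately show ?thesis by (meson enat_ord_simps(1) order_trans)
qed

text \<open>The coordinates in which two points differ would form a sensitive block. This settles
  the case in which Markov's inequality would divide by 0.\<close>

lemma constant_if_block_sensitivity_0:
  assumes "block_sensitivity n f = 0" and "x \<in> cube n" and "y \<in> cube n"
  shows "f x = f y"
proof (rule ccontr)
  assume neq: "f x \<noteq> f y"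
  define B where "B = {i\<in>{1..n}. x i \<noteq> y i}"
  have "flip_bits B x = y"
    using assms by (auto simp: flip_bits_def B_def cube_def PiE_def extensional_def fun_eq_iff)
  then have "card {B} \<le> block_sensitivity n f"
    using neq assms(2) by (intro sensitive_blocks_card_le[of x]) (auto simp: B_def disjoint_def)
  then show False using assms(1) by simp
qed

lemma distributional_complexity_le_corruption:
  assumes "0 \<le> \<epsilon>" and "product_distribution n \<mu>" and c: "product_min_corruption n \<epsilon> f = enat c"
  shows "distributional_complexity n \<mu> (4 * \<epsilon>) f \<le> enat (4 * block_sensitivity n f * c)"
proof -
  obtain p where \<mu>: "\<mu> = cube_pmf n p"
    using assms by (auto simp: product_distribution_def cube_pmf_def)
  let ?s = "block_sensitivity n f"
  show ?thesis
  proof (cases "?s = 0")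
    case True
    obtain x0 where x0: "x0 \<in> set_pmf \<mu>" using set_pmf_not_empty[of \<mu>] by blast
    have "f x = f x0" if "x \<in> set_pmf \<mu>" for x
      using constant_if_block_sensitivity_0[OF True] that x0 set_pmf_product_subset[OF assms(2)] by blast
    then have "measure_pmf.prob \<mu> {x. tree_output (Leaf (f x0)) x = f x} = 1"
      by (intro measure_pmf.prob_eq_1[THEN iffD2]) (auto simp: AE_measure_pmf_iff)
    then show ?thesis
      using assms(1) by (intro distributional_complexity_le[of n "Leaf (f x0)"]) auto
  next
    case False
    then have s: "real ?s > 0" by simp
    obtain T N g where *: "queries_within n T \<and> (\<forall>x. num_queries T x \<le> 4 * ?s * c) \<and>
      (\<forall>x. tree_output T x \<longleftrightarrow> 2 * ?s < 0 + N x) \<and>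
      measure_pmf.expectation \<mu> (\<lambda>x. real (g x)) \<le> \<epsilon> * real (4 * ?s) \<and>
      (\<forall>x\<in>set_pmf \<mu>. N x \<le> 4 * ?s \<and>
        (\<exists>\<B>. \<B> \<subseteq> Pow {i\<in>{1..n}. \<forall>b. p i \<noteq> return_pmf b} \<and>
         disjoint \<B> \<and> (\<forall>B\<in>\<B>. f x \<noteq> f (flip_bits B x)) \<and>
         (if f x then 4 * ?s - N x else N x) \<le> card \<B> + g x))"
      using certificate_rounds[OF c, of "4 * ?s" "2 * ?s" 0 p, folded \<mu>] by (elim exE)
    then have T: "queries_within n T" "num_queries T x \<le> 4 * ?s * c"
        "tree_output T x \<longleftrightarrow> 2 * ?s < N x"
      and g: "measure_pmf.expectation \<mu> (\<lambda>x. real (g x)) \<le> \<epsilon> * real (4 * ?s)" for x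
      by simp_all
    \<comment> \<open>Ties go to \<open>False\<close>, so a wrong output means at least
      \<open>2 * ?s\<close> wrong votes out of \<open>4 * ?s\<close>. At most \<open>?s\<close> of
      them are paid for by blocks.\<close>
    have wrong: "real ?s \<le> real (g x)" if x: "x \<in> set_pmf \<mu>" and neq: "tree_output T x \<noteq> f x" for x
    proof -
      obtain \<B> where \<B>: "\<B> \<subseteq> Pow {i\<in>{1..n}. \<forall>b. p i \<noteq> return_pmf b}" "disjoint \<B>"
        "\<forall>B\<in>\<B>. f x \<noteq> f (flip_bits B x)" "(if f x then 4 * ?s - N x else N x) \<le> card \<B> + g x"
        using * x by blast
      have "card \<B> \<le> ?s"
        using \<B>(1-3) x set_pmf_product_subset[OF assms(2)]
        by (intro sensitive_blocks_card_le[of x]) blast+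
      then show ?thesis using \<B>(4) neq by (auto simp: T(3) split: if_splits)
    qed
    have "measure_pmf.prob \<mu> {x. tree_output T x \<noteq> f x} \<le> measure_pmf.prob \<mu> {x. real ?s \<le> real (g x)}"
      using wrong by (intro measure_pmf.finite_measure_mono_AE) (auto simp: AE_measure_pmf_iff)
    also have "\<dots> \<le> measure_pmf.expectation \<mu> (\<lambda>x. real (g x)) / real ?s"
      using integral_Markov_inequality_measure[where M = "measure_pmf \<mu>" and A = "{}"
          and u = "\<lambda>x. real (g x)" and c = "real ?s"] s
      by (auto simp: \<mu> intro!: integrable_measure_pmf_finite finite_set_cube_pmf)
    also have "\<dots> \<le> 4 * \<epsilon>"
      using g s by (simp add: field_simps)
    finally have "1 - 4 * \<epsilon> \<le> measure_pmf.prob \<mu> {x. tree_output T x = f x}"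
      using measure_pmf.prob_compl[of "{x. tree_output T x = f x}" \<mu>]
      by (simp add: Compl_eq_Diff_UNIV[symmetric] Collect_neg_eq[symmetric])
    then show ?thesis
      using T by (intro distributional_complexity_le[of n T]) auto
  qed
qed

theorem theorem2:
  shows "\<exists>K::real. K > 0 \<and>
    (\<forall>(n::nat) (f :: (nat \<Rightarrow> bool) \<Rightarrow> bool) (\<epsilon>::real) (\<mu> :: (nat \<Rightarrow> bool) pmf).
       n \<ge> 1 \<longrightarrow> 0 \<le> \<epsilon> \<longrightarrow> \<epsilon> < 1/2 \<longrightarrow> product_distribution n \<mu> \<longrightarrow>
       ereal_of_enat (distributional_complexity n \<mu> (4 * \<epsilon>) f)
         \<le> ereal K * ereal_of_enat (product_min_corruption n \<epsilon> f)
             * ereal (real (block_sensitivity n f)))"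
proof (intro exI[of _ 4] conjI allI impI)
  fix n :: nat and f :: "(nat \<Rightarrow> bool) \<Rightarrow> bool" and \<epsilon> :: real and \<mu> :: "(nat \<Rightarrow> bool) pmf"
  assume \<epsilon>: "0 \<le> \<epsilon>" and \<mu>: "product_distribution n \<mu>"
  obtain c where c: "product_min_corruption n \<epsilon> f = enat c"
    using product_min_corruption_le[OF \<epsilon>] by (metis enat_ile)
  have "ereal_of_enat (distributional_complexity n \<mu> (4 * \<epsilon>) f)
      \<le> ereal_of_enat (enat (4 * block_sensitivity n f * c))"
    using distributional_complexity_le_corruption[OF \<epsilon> \<mu> c] by (simp only: ereal_of_enat_le_iff)
  then show "ereal_of_enat (distributional_complexity n \<mu> (4 * \<epsilon>) f)
      \<le> ereal 4 * ereal_of_enat (product_min_corruption n \<epsilon> f) * ereal (real (block_sensitivity n f))"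
    by (simp add: c mult_ac)
qed simp

end
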